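(* For all integers $n\geq 2$ and $k\geq 1$, $$2nb_{2n,k}=[k(k+1)+2n-2]b_{2n-2,k}+[2+2(k-1)(4n-4k-3)]b_{2n-2,k-1}+8(n-k+1)(2n-2k+1)b_{2n-2,k-2},$$ where $b_{2m,j}=0$ if $j<1$ or $j>m$.
   Context: For a permutation $\pi=a_1\cdots a_m$ of $\{1,\ldots,m\}$, a descent is an index $1\le i\le m-1$ with $a_i>a_{i+1}$. A fixed-point free involution is a permutation $\pi$ with $\pi^2=\mathrm{id}$ and no fixed points. Let $J_{m,j}$ be the number of fixed-point free involutions of $\{1,\ldots,m\}$ with exactly $j$ descents, and $J_{m}(t)=\sum_j J_{m,j}t^j$. For $m\geq1$ and $1\leq j\leq m$ define $$b_{2m,j}=\sum_{i=1}^{j}(-1)^{j-i}\frac{2m-2i}{2m-j-i}\binom{2m-j-i}{j-i}J_{2m,i}\quad\text{if }j<m,$$ $$b_{2m,j}=J_{2m,j}+\sum_{i=1}^{j-1}(-1)^{j-i}\frac{2m-2i}{2m-j-i}\binom{2m-j-i}{j-i}J_{2m,i}\quad\text{if }j=m.$$ These are the coefficients satisfying $J_{2m}(t)=\sum_{j=1}^{m}b_{2m,j}t^j(1+t)^{2m-2j}$. *)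

theory Defs
  imports Complex_Main "HOL-Combinatorics.Permutations"
begin

definition fpf_inv :: "nat \<Rightarrow> (nat \<Rightarrow> nat) \<Rightarrow> bool" where
  "fpf_inv m p \<longleftrightarrow> p permutes {1..m} \<and> p \<circ> p = id \<and> (\<forall>i\<in>{1..m}. p i \<noteq> i)"

definition des :: "nat \<Rightarrow> (nat \<Rightarrow> nat) \<Rightarrow> nat" where
  "des m p = card {i \<in> {1..<m}. p (Suc i) < p i}"

definition J :: "nat \<Rightarrow> nat \<Rightarrow> nat" where
  "J m j = card {p. fpf_inv m p \<and> des m p = j}"

text \<open>bcoef m j is b_{2m,j}; it is 0 when j < 1 or j > m.\<close>
definition bcoef :: "nat \<Rightarrow> int \<Rightarrow> real" where
  "bcoef m j =
     (if j < 1 \<or> j > int m then 0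
      else let j' = nat j in
        (\<Sum>i = 1..(if j' < m then j' else j' - 1).
            (-1) ^ (j' - i) * (real (2*m - 2*i) / real (2*m - j' - i))
              * real ((2*m - j' - i) choose (j' - i)) * real (J (2*m) i))
        + (if j' = m then real (J (2*m) j') else 0))"

end

theory Submission
  imports Defs "HOL-Library.Product_Lexorder" "HOL-Library.Multiset" "HOL-Library.Infinite_Set"
    "HOL-Library.FuncSet" "HOL-Computational_Algebra.Formal_Power_Series"
begin

text \<open>
  Pair a fixed-point free involution \<open>p\<close> of \<open>{1..2n}\<close> with a weakly increasing sequence \<open>f\<close> over
  \<open>{0..r}\<close> that increases strictly at the descents of \<open>p\<close>. For a given \<open>p\<close> with \<open>d\<close> descents there
  are \<open>r + 2n - d\<close> choose \<open>2n\<close> such sequences. The word with letters \<open>(f i, f (p i))\<close> is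
  lexicographically sorted, so it is determined by its multiset of letters, and recording the letters
  \<open>(x, y)\<close> with \<open>x < y\<close> turns the pairs \<open>(p, f)\<close> into the multisets of \<open>n\<close> pairs from \<open>x < y \<le> r\<close>.
  The number of these multisets, a binomial coefficient, satisfies a first-order recurrence in \<open>n\<close>;
  comparing coefficients in the basis of the polynomials \<open>r + 2n - d\<close> choose \<open>2n\<close> gives a three-term
  recurrence for \<open>J\<close>. The numbers defined by the claimed recurrence expand the solution of that
  recurrence in the basis \<open>t\<^sup>j (1 + t)\<^sup>2\<^sup>n\<^sup>-\<^sup>2\<^sup>j\<close>, and inverting this expansion by a Vandermonde
  convolution yields the defining formula of \<open>bcoef\<close>.
\<close>

subsection \<open>Sequences compatible with a fixed-point free involution\<close>

text \<open>The bound \<open>b\<close> is exclusive, so the values \<open>{0..r}\<close> of the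
  overview correspond to \<open>b = Suc r\<close>. Extensionality makes a sequence determined by its
  values on \<open>{1..N}\<close>, so that sequences can be counted.\<close>

definition marked_seqs :: "nat \<Rightarrow> nat \<Rightarrow> nat set \<Rightarrow> (nat \<Rightarrow> nat) set" where
  "marked_seqs N b D =
     {f \<in> {1..N} \<rightarrow>\<^sub>E {..<b}. \<forall>i\<in>{1..<N}. f i \<le> f (Suc i) \<and> (i \<in> D \<longrightarrow> f i < f (Suc i))}"

lemma finite_marked_seqs: "finite (marked_seqs N b D)"
  unfolding marked_seqs_def by (rule finite_subset[OF _ finite_PiE[of "{1..N}" "\<lambda>_. {..<b}"]]) auto

lemma marked_seqs_mono:
  assumes "f \<in> marked_seqs N b D" "1 \<le> i" "i \<le> j" "j \<le> N"
  shows "f i \<le> f j"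
  using assms(3,4)
proof (induction j rule: dec_induct)
  case (step j)
  then have "f j \<le> f (Suc j)"
    using assms(1,2) by (auto simp: marked_seqs_def)
  with step show ?case by simp
qed simp

text \<open>Split by the last value \<open>v\<close>: monotonicity reduces its constraint on the
  earlier values to a bound by \<open>v\<close>, which is strict exactly when \<open>N\<close> is
  marked.\<close>

lemma marked_seqs_Suc:
  "marked_seqs (Suc N) b D =
     (\<Union>v<b. (\<lambda>f. f(Suc N := v)) ` marked_seqs N (if N \<in> D then v else Suc v) D)"
  if "0 \<notin> D"
proof (intro equalityI subsetI)
  fix f assume f: "f \<in> marked_seqs (Suc N) b D"
  let ?v = "f (Suc N)"
  let ?g = "restrict f {1..N}"
  have v: "?v < b" using f by (auto simp: marked_seqs_def PiE_iff)
  have bound: "f i < (if N \<in> D then ?v else Suc ?v)" if i: "i \<in> {1..N}" for i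
  proof -
    have "f i \<le> f N" using marked_seqs_mono[OF f, of i N] i by auto
    moreover have "f N \<le> ?v" "N \<in> D \<longrightarrow> f N < ?v"
      using f i by (auto simp: marked_seqs_def)
    ultimately show ?thesis by auto
  qed
  have "?g \<in> marked_seqs N (if N \<in> D then ?v else Suc ?v) D"
    using f bound unfolding marked_seqs_def by (auto simp: PiE_iff)
  moreover have "f = ?g(Suc N := ?v)"
    using f by (auto simp: marked_seqs_def fun_eq_iff PiE_iff extensional_def)
  ultimately show "f \<in> (\<Union>v<b. (\<lambda>f. f(Suc N := v)) ` marked_seqs N (if N \<in> D then v else Suc v) D)"
    using v by blast
next
  fix f assume "f \<in> (\<Union>v<b. (\<lambda>f. f(Suc N := v)) ` marked_seqs N (if N \<in> D then v else Suc v) D)"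
  then obtain v g where v: "v < b" and g: "g \<in> marked_seqs N (if N \<in> D then v else Suc v) D"
    and f: "f = g(Suc N := v)" by auto
  have gb: "g i < (if N \<in> D then v else Suc v)" if "i \<in> {1..N}" for i
    using g that unfolding marked_seqs_def by (auto simp: PiE_iff)
  have gb': "g i < b" if "i \<in> {1..N}" for i using gb[OF that] v by (auto split: if_splits)
  have gN: "g N \<le> v" "N \<in> D \<Longrightarrow> g N < v" if "N \<ge> 1"
    using gb[of N] that by (auto split: if_splits)
  have ext: "g i = undefined" if "i \<notin> {1..N}" for i
    using g that unfolding marked_seqs_def by (auto simp: PiE_iff extensional_def)
  have "f i \<le> f (Suc i) \<and> (i \<in> D \<longrightarrow> f i < f (Suc i))" if i: "i \<in> {1..<Suc N}" for i
  proof (cases "i = N")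
    case True then show ?thesis using gN i f by auto
  next
    case False then show ?thesis using g i f by (auto simp: marked_seqs_def)
  qed
  then show "f \<in> marked_seqs (Suc N) b D"
    using v gb' ext unfolding marked_seqs_def f by (auto simp: PiE_iff extensional_def)
qed

text \<open>Hockey-stick summation; \<open>s \<le> N\<close> makes the right side vanish at
  \<open>b = 0\<close>.\<close>

lemma sum_choose_shift:
  assumes "s \<le> N"
  shows "(\<Sum>v<b. (v + s) choose N) = (b + s) choose Suc N"
  using assms by (induction b) auto

lemma card_marked_seqs:
  assumes "D \<subseteq> {1..<N}"
  shows "card (marked_seqs N (Suc r) D) = (r + N - card D) choose N"
proof -
  \<comment> \<open>Generalised for the induction: splitting off the last value changes the bound
    \<open>b\<close>, and only the marks below \<open>N\<close> constrain a sequence of length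
    \<open>N\<close>.\<close>
  have "card (marked_seqs N b D) = (b + N - 1 - card (D \<inter> {..<N})) choose N" if "0 \<notin> D" for N b D
    using that
  proof (induction N arbitrary: b)
    case 0
    have "marked_seqs 0 b D = {\<lambda>x. undefined}" by (auto simp: marked_seqs_def)
    then show ?case by simp
  next
    case (Suc N)
    let ?d = "card (D \<inter> {..<N})"
    let ?A = "\<lambda>v. marked_seqs N (if N \<in> D then v else Suc v) D"
    \<comment> \<open>This keeps the truncated subtractions below exact.\<close>
    have d: "?d \<le> N - 1"
    proof -
      have "D \<inter> {..<N} \<subseteq> {1..<N}" using Suc.prems by (auto intro!: Suc_leI gr0I)
      then show ?thesis using card_mono[of "{1..<N}"] by fastforce
    qed
    have inj: "inj_on (\<lambda>f. f(Suc N := v)) (?A v)" for v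
    proof (rule inj_onI)
      fix f g assume "f \<in> ?A v" "g \<in> ?A v" and eq: "f(Suc N := v) = g(Suc N := v)"
      then have "f (Suc N) = g (Suc N)"
        by (auto simp: marked_seqs_def PiE_iff extensional_def)
      with eq show "f = g" by (metis fun_upd_triv fun_upd_upd)
    qed
    have "card (marked_seqs (Suc N) b D) = (\<Sum>v<b. card ((\<lambda>f. f(Suc N := v)) ` ?A v))"
      unfolding marked_seqs_Suc[OF Suc.prems]
    proof (rule card_UN_disjoint)
      show "\<forall>i\<in>{..<b}. \<forall>j\<in>{..<b}. i \<noteq> j \<longrightarrow>
          (\<lambda>f. f(Suc N := i)) ` ?A i \<inter> (\<lambda>f. f(Suc N := j)) ` ?A j = {}"
        by (auto dest: fun_cong[of _ _ "Suc N"])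
    qed (auto simp: finite_marked_seqs)
    also have "\<dots> = (\<Sum>v<b. card (?A v))"
      by (simp add: card_image[OF inj])
    also have "\<dots> = (\<Sum>v<b. ((if N \<in> D then v else Suc v) + N - 1 - ?d) choose N)"
      using Suc by simp
    also have "\<dots> = (b + Suc N - 1 - card (D \<inter> {..<Suc N})) choose Suc N"
    proof (cases "N \<in> D")
      case True
      then have "N \<ge> 1" using Suc.prems by (cases N) auto
      have "D \<inter> {..<Suc N} = insert N (D \<inter> {..<N})" using True by (auto simp: less_Suc_eq)
      then have c: "card (D \<inter> {..<Suc N}) = Suc ?d" by simp
      have "(\<Sum>v<b. ((if N \<in> D then v else Suc v) + N - 1 - ?d) choose N)
         = (\<Sum>v<b. (v + (N - 1 - ?d)) choose N)"
        using d True \<open>N \<ge> 1\<close> by (intro sum.cong) (auto intro!: arg_cong[of _ _ "\<lambda>x. x choose N"])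
      also have "\<dots> = (b + (N - 1 - ?d)) choose Suc N" by (rule sum_choose_shift) simp
      also have "b + (N - 1 - ?d) = b + Suc N - 1 - card (D \<inter> {..<Suc N})"
        using d c \<open>N \<ge> 1\<close> by simp
      finally show ?thesis .
    next
      case False
      then have "D \<inter> {..<Suc N} = D \<inter> {..<N}" by (auto simp: less_Suc_eq)
      then have c: "card (D \<inter> {..<Suc N}) = ?d" by simp
      have "(\<Sum>v<b. ((if N \<in> D then v else Suc v) + N - 1 - ?d) choose N)
         = (\<Sum>v<b. (v + (N - ?d)) choose N)"
        using d False by (intro sum.cong) (auto intro!: arg_cong[of _ _ "\<lambda>x. x choose N"])
      also have "\<dots> = (b + (N - ?d)) choose Suc N" by (rule sum_choose_shift) simp
      also have "b + (N - ?d) = b + Suc N - 1 - card (D \<inter> {..<Suc N})"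
        using d c by simp
      finally show ?thesis .
    qed
    finally show ?case .
  qed
  moreover have "0 \<notin> D" "D \<inter> {..<N} = D" using assms by auto
  ultimately show ?thesis by (simp del: binomial_Suc_Suc)
qed

section \<open>Fixed-point free involutions and compatible sequences\<close>

lemma fpf_inv_simps:
  assumes "fpf_inv m p"
  shows "p (p i) = i" "p i \<in> {1..m} \<longleftrightarrow> i \<in> {1..m}" "i \<in> {1..m} \<Longrightarrow> p i \<noteq> i"
    "i \<notin> {1..m} \<Longrightarrow> p i = i" "p i = p j \<longleftrightarrow> i = j" "p ` {1..m} = {1..m}"
proof -
  have p: "p permutes {1..m}" and pp: "p \<circ> p = id" and *: "\<forall>i\<in>{1..m}. p i \<noteq> i"
    using assms by (auto simp: fpf_inv_def)
  show "p (p i) = i" using pp by (metis comp_apply id_apply)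
  show "p i \<in> {1..m} \<longleftrightarrow> i \<in> {1..m}" by (rule permutes_in_image[OF p])
  show "i \<in> {1..m} \<Longrightarrow> p i \<noteq> i" using * by auto
  show "i \<notin> {1..m} \<Longrightarrow> p i = i" using p by (rule permutes_not_in)
  show "p i = p j \<longleftrightarrow> i = j" using permutes_inj[OF p] by (auto dest: injD)
  show "p ` {1..m} = {1..m}" by (rule permutes_image[OF p])
qed

text \<open>The condition ranges over all \<open>i < j\<close> instead of neighbours because the
  word arguments compare arbitrary positions; \<open>compat_eq_marked_seqs\<close> links it to the
  local form that is counted.\<close>

definition compat :: "nat \<Rightarrow> nat \<Rightarrow> (nat \<Rightarrow> nat) \<Rightarrow> (nat \<Rightarrow> nat) set" where
  "compat m b p = {f \<in> {1..m} \<rightarrow>\<^sub>E {..<b}.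
     \<forall>i j. 1 \<le> i \<and> i < j \<and> j \<le> m \<longrightarrow> f i \<le> f j \<and> (f i = f j \<longrightarrow> p i < p j)}"

text \<open>If \<open>f i = f j\<close>, monotonicity makes \<open>f\<close> constant between
  \<open>i\<close> and \<open>j\<close>; strictness at the descents then leaves only ascents of
  \<open>p\<close> there, so \<open>p\<close> increases along each block of equal values.\<close>

lemma compat_eq_marked_seqs:
  assumes "fpf_inv m p"
  shows "compat m b p = marked_seqs m b {i \<in> {1..<m}. p (Suc i) < p i}"
proof (intro equalityI subsetI)
  fix f assume f: "f \<in> compat m b p"
  have "f i \<le> f (Suc i) \<and> (p (Suc i) < p i \<longrightarrow> f i < f (Suc i))" if "i \<in> {1..<m}" for i
  proof -
    have "f i \<le> f (Suc i) \<and> (f i = f (Suc i) \<longrightarrow> p i < p (Suc i))"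
      using f that unfolding compat_def by auto
    then show ?thesis by auto
  qed
  then show "f \<in> marked_seqs m b {i \<in> {1..<m}. p (Suc i) < p i}"
    using f by (auto simp: compat_def marked_seqs_def)
next
  fix f assume f: "f \<in> marked_seqs m b {i \<in> {1..<m}. p (Suc i) < p i}"
  have ascent: "p i < p (Suc i)" if "1 \<le> i" "i < m" "f i = f (Suc i)" for i
  proof -
    have "\<not> p (Suc i) < p i" using f that unfolding marked_seqs_def by auto
    moreover have "p i \<noteq> p (Suc i)" using fpf_inv_simps(5)[OF assms] by simp
    ultimately show ?thesis by simp
  qed
  have "p i < p j" if ij: "i < j" "1 \<le> i" "j \<le> m" "f i = f j" for i j
    using Suc_leI[OF ij(1)] ij(3,4)
  proof (induction j rule: dec_induct)
    case base then show ?case using ascent ij by simp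
  next
    case (step j)
    have "f i \<le> f j" using marked_seqs_mono[OF f, of i j] step ij(2) by simp
    moreover have "f j \<le> f (Suc j)" using marked_seqs_mono[OF f, of j "Suc j"] step by simp
    ultimately have "f i = f j" "f j = f (Suc j)" using step.prems by auto
    with step show ?case using ascent[of j] ij by auto
  qed
  then show "f \<in> compat m b p"
    using f marked_seqs_mono[OF f] unfolding compat_def by (auto simp: marked_seqs_def)
qed

subsection \<open>Compatible pairs and multisets of arcs\<close>

definition arc_word :: "nat \<Rightarrow> (nat \<Rightarrow> nat) \<Rightarrow> (nat \<Rightarrow> nat) \<Rightarrow> (nat \<times> nat) list" where
  "arc_word m p f = map (\<lambda>i. (f i, f (p i))) [1..<Suc m]"

text \<open>For compatible \<open>f\<close>, each 2-cycle of \<open>p\<close> contributes an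
  off-diagonal letter and its transpose; \<open>x < y\<close> selects one of the two.\<close>

definition upper_arcs :: "nat \<Rightarrow> (nat \<Rightarrow> nat) \<Rightarrow> (nat \<Rightarrow> nat) \<Rightarrow> (nat \<times> nat) multiset" where
  "upper_arcs m p f = filter_mset (\<lambda>(x, y). x < y) (mset (arc_word m p f))"

lemma length_arc_word [simp]: "length (arc_word m p f) = m"
  by (simp add: arc_word_def)

lemma nth_arc_word: "i < m \<Longrightarrow> arc_word m p f ! i = (f (Suc i), f (p (Suc i)))"
  by (simp add: arc_word_def del: upt_Suc)

lemma compatD:
  assumes "f \<in> compat m b p" "1 \<le> i" "i < j" "j \<le> m"
  shows "f i \<le> f j" "f i = f j \<Longrightarrow> p i < p j"
  using assms unfolding compat_def by auto

lemma compat_bound: "f \<in> compat m b p \<Longrightarrow> i \<in> {1..m} \<Longrightarrow> f i < b"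
  unfolding compat_def by auto

text \<open>If \<open>i\<close> and \<open>p i\<close> lay in one block, \<open>p\<close> would have
  to increase from the smaller to the larger of them, but it exchanges them.\<close>

lemma compat_off_diagonal:
  assumes p: "fpf_inv m p" and f: "f \<in> compat m b p" and i: "i \<in> {1..m}"
  shows "f (p i) \<noteq> f i"
proof
  note p' = fpf_inv_simps[OF p]
  assume eq: "f (p i) = f i"
  have pi: "p i \<in> {1..m}" "p i \<noteq> i" using p' i by auto
  then consider "i < p i" | "p i < i" by linarith
  then show False
  proof cases
    case 1
    then have "p i < p (p i)" using compatD(2)[OF f, of i "p i"] i pi eq by auto
    then show False using 1 p' by simp
  next
    case 2
    then have "p (p i) < p i" using compatD(2)[OF f, of "p i" i] i pi eq by auto
    then show False using 2 p' by simp
  qed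
qed

text \<open>When first coordinates tie, compatibility gives \<open>p i < p j\<close>, and
  monotonicity of \<open>f\<close> then orders the second coordinates. The order on pairs is
  lexicographic.\<close>

lemma sorted_arc_word:
  assumes p: "fpf_inv m p" and f: "f \<in> compat m b p"
  shows "sorted (arc_word m p f)"
proof -
  note p' = fpf_inv_simps[OF p]
  have "arc_word m p f ! i \<le> arc_word m p f ! j" if "i < j" "j < m" for i j
  proof -
    let ?i = "Suc i" and ?j = "Suc j"
    have "f (p ?i) \<le> f (p ?j)" if "f ?i = f ?j"
    proof -
      have "p ?i < p ?j" using compatD(2)[OF f, of ?i ?j] that \<open>i < j\<close> \<open>j < m\<close> by auto
      moreover have "p ?i \<in> {1..m}" "p ?j \<in> {1..m}" using p'(2) \<open>i < j\<close> \<open>j < m\<close> by auto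
      ultimately show ?thesis using compatD(1)[OF f] by auto
    qed
    moreover have "f ?i \<le> f ?j" using compatD(1)[OF f, of ?i ?j] that by auto
    ultimately show ?thesis using that by (auto simp: nth_arc_word intro: le_neq_implies_less)
  qed
  then show ?thesis by (auto simp: sorted_iff_nth_mono_less)
qed

lemma symmetric_mset_decomp:
  fixes M :: "('a::linorder \<times> 'a) multiset"
  assumes sym: "image_mset prod.swap M = M" and off: "\<And>x. (x, x) \<notin># M"
  shows "M = filter_mset (\<lambda>(x, y). x < y) M + image_mset prod.swap (filter_mset (\<lambda>(x, y). x < y) M)"
    (is "_ = ?F + _")
proof -
  have "M = ?F + filter_mset (\<lambda>z. \<not> (case z of (x, y) \<Rightarrow> x < y)) M" by simp
  also have "filter_mset (\<lambda>z. \<not> (case z of (x, y) \<Rightarrow> x < y)) M = filter_mset (\<lambda>(x, y). y < x) M"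
    by (rule filter_mset_cong) (use off in \<open>auto simp: not_less order.order_iff_strict\<close>)
  also have "\<dots> = filter_mset (\<lambda>(x, y). y < x) (image_mset prod.swap M)" by (simp add: sym)
  also have "\<dots> = image_mset prod.swap ?F"
    by (subst filter_mset_image_mset) (auto intro!: arg_cong[of _ _ "image_mset prod.swap"] filter_mset_cong)
  finally show ?thesis .
qed

text \<open>Reindexing the letters by the bijection \<open>p\<close> exchanges their coordinates,
  since \<open>p\<close> is an involution.\<close>

lemma arc_word_symmetric:
  assumes p: "fpf_inv m p" and f: "f \<in> compat m b p"
  shows "image_mset prod.swap (mset (arc_word m p f)) = mset (arc_word m p f)"
    and "(x, x) \<notin># mset (arc_word m p f)"
proof -
  note p' = fpf_inv_simps[OF p]
  have w: "mset (arc_word m p f) = image_mset (\<lambda>i. (f i, f (p i))) (mset_set {1..m})"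
    by (simp add: arc_word_def atLeastLessThanSuc_atLeastAtMost del: upt_Suc)
  have "inj_on p {1..m}" using p' by (auto intro: inj_onI)
  then have "image_mset p (mset_set {1..m}) = mset_set {1..m}"
    by (simp only: image_mset_mset_set p')
  then have "image_mset (\<lambda>i. (f i, f (p i))) (mset_set {1..m})
      = image_mset (\<lambda>i. (f i, f (p i))) (image_mset p (mset_set {1..m}))" by simp
  also have "\<dots> = image_mset prod.swap (image_mset (\<lambda>i. (f i, f (p i))) (mset_set {1..m}))"
    by (simp add: multiset.map_comp o_def p')
  finally show "image_mset prod.swap (mset (arc_word m p f)) = mset (arc_word m p f)"
    unfolding w by simp
  show "(x, x) \<notin># mset (arc_word m p f)"
    unfolding w using compat_off_diagonal[OF p f] by force
qed

lemma arc_word_decomp: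
  assumes "fpf_inv m p" and "f \<in> compat m b p"
  shows "mset (arc_word m p f) = upper_arcs m p f + image_mset prod.swap (upper_arcs m p f)"
  unfolding upper_arcs_def by (intro symmetric_mset_decomp arc_word_symmetric[OF assms])

lemma arc_word_inj:
  assumes p: "fpf_inv m p" and f: "f \<in> compat m b p"
    and q: "fpf_inv m q" and g: "g \<in> compat m b q"
    and eq: "arc_word m p f = arc_word m q g"
  shows "p = q \<and> f = g"
proof -
  note p' = fpf_inv_simps[OF p] and q' = fpf_inv_simps[OF q]
  have fg: "f i = g i \<and> f (p i) = g (q i)" if "i \<in> {1..m}" for i
    using arg_cong[OF eq, of "\<lambda>w. w ! (i - 1)"] that by (cases i) (auto simp: nth_arc_word)
  have "f = g"
  proof (rule PiE_ext)
    show "f \<in> {1..m} \<rightarrow>\<^sub>E {..<b}" "g \<in> {1..m} \<rightarrow>\<^sub>E {..<b}" using f g by (auto simp: compat_def)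
  qed (use fg in auto)
  \<comment> \<open>At the least \<open>i\<close> with \<open>p i \<noteq> q i\<close>, the smaller of the two values is taken by the other involution at a smaller index of the same block.\<close>
  have main: "\<not> p i < q i"
    if "i \<in> {1..m}" and IH: "\<And>j. j < i \<Longrightarrow> p j = q j"
      and p: "fpf_inv m p" and f: "f \<in> compat m b p" and q: "fpf_inv m q" and g: "f \<in> compat m b q"
      and fg: "\<And>i. i \<in> {1..m} \<Longrightarrow> f (p i) = f (q i)" for i p q
  proof
    note p' = fpf_inv_simps[OF p] and q' = fpf_inv_simps[OF q]
    assume lt: "p i < q i"
    \<comment> \<open>Here \<open>q j = p i\<close>, and \<open>j\<close> lies in the block of
      \<open>i\<close> because \<open>f (q (p i)) = f (p (p i)) = f i\<close>.\<close>
    define j where "j = q (p i)"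
    have pi: "p i \<in> {1..m}" using p' that by blast
    then have j: "j \<in> {1..m}" unfolding j_def using q' by blast
    have qj: "q j = p i" by (simp add: j_def q')
    have "f j = f i" unfolding j_def using fg[OF pi] p' by simp
    have "j < i"
    proof (rule ccontr)
      assume "\<not> j < i"
      moreover have "j \<noteq> i" using qj lt by auto
      ultimately have "i < j" by simp
      then have "q i < q j" using compatD(2)[OF g, of i j] \<open>f j = f i\<close> j that(1) by auto
      with qj lt show False by simp
    qed
    with IH have "p j = p i" using qj by simp
    with p' \<open>j < i\<close> show False by simp
  qed
  have fpq: "f (p i) = f (q i)" if "i \<in> {1..m}" for i using fg[OF that] \<open>f = g\<close> by simp
  have "p i = q i" for i
  proof (induction i rule: less_induct)
    case (less i)
    show ?case
    proof (cases "i \<in> {1..m}")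
      case True
      have "\<not> p i < q i" using main[OF True less p f q] g fpq \<open>f = g\<close> by auto
      moreover have "\<not> q i < p i" using main[OF True less[symmetric] q _ p f] g fpq \<open>f = g\<close> by auto
      ultimately show ?thesis by simp
    qed (simp add: p' q')
  qed
  with \<open>f = g\<close> show ?thesis by auto
qed

section \<open>Reconstructing an involution from a sorted symmetric word\<close>

lemma count_image_mset_swap: "count (image_mset prod.swap M) (prod.swap z) = count M z"
  by (induction M) (auto simp: prod_eq_iff)

text \<open>The positions of each letter are matched, in increasing order, with the positions of its
  transpose. Symmetry makes these sets equally large, the absence of diagonal letters excludes fixed
  points, and \<open>f\<close> reads off the first coordinates.\<close>

lemma ex_compat_arc_word:
  assumes sorted: "sorted w" and sym: "image_mset prod.swap (mset w) = mset w"
    and off: "\<And>x. (x, x) \<notin> set w" and bound: "\<And>x y. (x, y) \<in> set w \<Longrightarrow> x < b"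
  obtains p f where "fpf_inv (length w) p" "f \<in> compat (length w) b p" "arc_word (length w) p f = w"
proof -
  define m where "m = length w"
  define c where "c i = w ! (i - 1)" for i
  define W where "W z = {i \<in> {1..m}. c i = z}" for z
  \<comment> \<open>\<open>W z\<close> holds the positions of the letter \<open>z\<close>. The
    inverse of \<open>enumerate\<close> gives the rank of \<open>i\<close> among the positions of
    its own letter, and \<open>p i\<close> is the position of the same rank for the transposed
    letter.\<close>
  define p where "p i = (if i \<in> {1..m} then
      enumerate (W (prod.swap (c i))) (the_inv_into {..<card (W (c i))} (enumerate (W (c i))) i) else i)" for i
  define f where "f i = (if i \<in> {1..m} then fst (c i) else undefined)" for i
  have fin: "finite (W z)" for z by (auto simp: W_def)
  have cw: "c i \<in> set w" if "i \<in> {1..m}" for i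
    using that by (auto simp: c_def m_def)
  have c_mono: "c i \<le> c j" if "i \<in> {1..m}" "j \<in> {1..m}" "i \<le> j" for i j
    using that sorted by (auto simp: c_def m_def intro!: sorted_nth_mono)
  have card_W: "card (W z) = count (mset w) z" for z
  proof -
    have "W z = Suc ` {i. i < length w \<and> w ! i = z}"
    proof (intro equalityI subsetI)
      fix i assume "i \<in> W z"
      then have "i = Suc (i - 1)" "i - 1 < length w" "w ! (i - 1) = z"
        by (auto simp: W_def m_def c_def)
      then show "i \<in> Suc ` {i. i < length w \<and> w ! i = z}" by blast
    qed (auto simp: W_def m_def c_def)
    then have "card (W z) = card {i. i < length w \<and> w ! i = z}" by (simp add: card_image)
    also have "\<dots> = count (mset w) z"
      by (simp add: count_mset count_list_eq_length_filter length_filter_conv_card eq_commute)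
    finally show ?thesis .
  qed
  have card_swap: "card (W (prod.swap z)) = card (W z)" for z
  proof -
    have "count (mset w) (prod.swap z) = count (image_mset prod.swap (mset w)) (prod.swap z)"
      by (simp add: sym)
    also have "\<dots> = count (mset w) z"
      by (rule count_image_mset_swap)
    finally show ?thesis by (simp add: card_W)
  qed
  have enum: "bij_betw (enumerate (W z)) {..<card (W z)} (W z)" for z
    by (rule finite_bij_enumerate[OF fin])
  define r where "r i = the_inv_into {..<card (W (c i))} (enumerate (W (c i))) i" for i
  have r: "r i < card (W (c i))" "enumerate (W (c i)) (r i) = i" if i: "i \<in> {1..m}" for i
  proof -
    have iW: "i \<in> W (c i)" using i by (simp add: W_def)
    then show "enumerate (W (c i)) (r i) = i" unfolding r_def
      using f_the_inv_into_f_bij_betw[OF enum] by simp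
    show "r i < card (W (c i))" unfolding r_def
      using bij_betwE[OF bij_betw_the_inv_into[OF enum]] iW by blast
  qed
  have p_eq: "p i = enumerate (W (prod.swap (c i))) (r i)" if "i \<in> {1..m}" for i
    using that by (simp add: p_def r_def)
  have pW: "p i \<in> W (prod.swap (c i))" if "i \<in> {1..m}" for i
    using p_eq[OF that] r[OF that] card_swap finite_enumerate_in_set[OF fin] by simp
  then have pm: "p i \<in> {1..m}" and cp: "c (p i) = prod.swap (c i)" if "i \<in> {1..m}" for i
    using that by (auto simp: W_def)
  have pp: "p (p i) = i" for i
  proof (cases "i \<in> {1..m}")
    case True
    have "enumerate (W (prod.swap (c i))) (r (p i)) = enumerate (W (prod.swap (c i))) (r i)"
      using r(2)[OF pm[OF True]] cp[OF True] p_eq[OF True] by simp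
    moreover have "r (p i) < card (W (prod.swap (c i)))" using r(1)[OF pm[OF True]] cp[OF True] by simp
    moreover have "r i < card (W (prod.swap (c i)))" using r(1)[OF True] card_swap by simp
    ultimately have "r (p i) = r i"
      using inj_onD[OF bij_betw_imp_inj_on[OF enum]] by blast
    then have "p (p i) = enumerate (W (c i)) (r i)" using p_eq[OF pm[OF True]] cp[OF True] by simp
    then show ?thesis using r[OF True] by simp
  qed (auto simp: p_def)
  have "fpf_inv m p"
    unfolding fpf_inv_def
  proof (intro conjI ballI)
    show "p permutes {1..m}"
      unfolding permutes_def
    proof (intro conjI allI impI)
      fix y show "\<exists>!x. p x = y" by (metis pp)
    qed (auto simp: p_def)
    show "p \<circ> p = id" by (auto simp: pp)
    fix i assume i: "i \<in> {1..m}"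
    show "p i \<noteq> i"
    proof
      assume "p i = i"
      then have "c i = prod.swap (c i)" using cp[OF i] by simp
      then have "c i = (fst (c i), fst (c i))" by (metis prod.collapse fst_swap)
      with cw[OF i] off show False by metis
    qed
  qed
  moreover have "f \<in> compat m b p"
    unfolding compat_def
  proof (intro CollectI conjI allI impI)
    show "f \<in> {1..m} \<rightarrow>\<^sub>E {..<b}"
      using bound cw by (auto simp: f_def PiE_iff extensional_def) (metis prod.collapse)
    fix i j assume "1 \<le> i \<and> i < j \<and> j \<le> m"
    then have i: "i \<in> {1..m}" and j: "j \<in> {1..m}" and ij: "i < j" by auto
    have le: "c i \<le> c j" using c_mono i j ij by simp
    then show "f i \<le> f j" using i j by (auto simp: f_def less_eq_prod_def)
    assume "f i = f j"
    then have fst_eq: "fst (c i) = fst (c j)" using i j by (simp add: f_def)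
    \<comment> \<open>For equal letters the matching preserves ranks. For different letters with
      equal first coordinates the transposed letters are strictly ordered, hence so are their
      positions in the sorted word.\<close>
    show "p i < p j"
    proof (cases "c i = c j")
      case True
      have "r i < r j"
      proof (rule ccontr)
        assume "\<not> r i < r j"
        then have "r j \<le> r i" by simp
        then have "enumerate (W (c i)) (r j) \<le> enumerate (W (c i)) (r i)"
          using finite_enumerate_mono[OF _ fin r(1)[OF i], of "r j"] by (cases "r i = r j") auto
        then show False using r(2)[OF i] r(2)[OF j] True ij by simp
      qed
      then show ?thesis
        using finite_enumerate_mono[of "r i" "r j"] fin r(1)[OF j] card_swap True p_eq i j by simp
    next
      case False
      then have "snd (c i) < snd (c j)"
        using le fst_eq by (auto simp: less_eq_prod_def prod_eq_iff)
      then have "\<not> c (p j) \<le> c (p i)" using cp i j by (auto simp: less_eq_prod_def)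
      then show ?thesis using c_mono[OF pm[OF j] pm[OF i]] by (metis not_le)
    qed
  qed
  moreover have "arc_word m p f = w"
  proof (rule nth_equalityI)
    fix i assume "i < length (arc_word m p f)"
    then have i: "i < m" by simp
    then have im: "Suc i \<in> {1..m}" by simp
    then have "f (p (Suc i)) = snd (c (Suc i))" using pm cp by (simp add: f_def)
    moreover have "f (Suc i) = fst (c (Suc i))" using im by (simp add: f_def)
    ultimately show "arc_word m p f ! i = w ! i"
      using i by (simp add: nth_arc_word c_def)
  qed (simp add: m_def)
  ultimately show ?thesis using that unfolding m_def by blast
qed

text \<open>The upper half determines the symmetric multiset, hence the sorted word, hence the pair.
  Conversely, sorting \<open>M\<close> together with its transpose gives a word to which
  \<open>ex_compat_arc_word\<close> applies.\<close>

lemma bij_betw_upper_arcs: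
  "bij_betw (\<lambda>(p, f). upper_arcs (2 * n) p f)
     (SIGMA p:{p. fpf_inv (2 * n) p}. compat (2 * n) b p)
     (multisets_of_size {(x, y). x < y \<and> y < b} n)"
  unfolding bij_betw_def
proof (intro conjI equalityI subsetI)
  show "inj_on (\<lambda>(p, f). upper_arcs (2 * n) p f) (SIGMA p:{p. fpf_inv (2 * n) p}. compat (2 * n) b p)"
  proof (rule inj_onI, clarsimp)
    fix p f q g
    assume p: "fpf_inv (2 * n) p" and f: "f \<in> compat (2 * n) b p"
      and q: "fpf_inv (2 * n) q" and g: "g \<in> compat (2 * n) b q"
      and eq: "upper_arcs (2 * n) p f = upper_arcs (2 * n) q g"
    have "mset (arc_word (2 * n) p f) = mset (arc_word (2 * n) q g)"
      using arc_word_decomp[OF p f] arc_word_decomp[OF q g] eq by simp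
    then have "arc_word (2 * n) p f = arc_word (2 * n) q g"
      using sorted_arc_word[OF p f] sorted_arc_word[OF q g]
      by (metis sorted_list_of_multiset_mset sorted_sort_id)
    then show "p = q \<and> f = g" by (rule arc_word_inj[OF p f q g])
  qed
next
  fix M assume "M \<in> (\<lambda>(p, f). upper_arcs (2 * n) p f) ` (SIGMA p:{p. fpf_inv (2 * n) p}. compat (2 * n) b p)"
  then obtain p f where p: "fpf_inv (2 * n) p" and f: "f \<in> compat (2 * n) b p"
    and M: "M = upper_arcs (2 * n) p f" by auto
  have "2 * n = size (mset (arc_word (2 * n) p f))" by simp
  also have "\<dots> = 2 * size M" unfolding arc_word_decomp[OF p f] M by simp
  finally have "size M = n" by simp
  moreover have "y < b" if "(x, y) \<in># M" for x y
    using that compat_bound[OF f] fpf_inv_simps(2)[OF p]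
    by (auto simp: M upper_arcs_def arc_word_def simp del: upt_Suc)
  moreover have "x < y" if "(x, y) \<in># M" for x y using that by (auto simp: M upper_arcs_def)
  ultimately show "M \<in> multisets_of_size {(x, y). x < y \<and> y < b} n"
    by (auto simp: multisets_of_size_def)
next
  fix M :: "(nat \<times> nat) multiset" assume M: "M \<in> multisets_of_size {(x, y). x < y \<and> y < b} n"
  then have lt: "x < y" "y < b" if "(x, y) \<in># M" for x y
    using that by (auto simp: multisets_of_size_def)
  have size: "size M = n" using M by (simp add: multisets_of_size_def)
  define w where "w = sorted_list_of_multiset (M + image_mset prod.swap M)"
  have mset_w: "mset w = M + image_mset prod.swap M" by (simp add: w_def)
  have len: "length w = 2 * n" using arg_cong[OF mset_w, of size] size by simp
  have set_w: "set w = set_mset M \<union> prod.swap ` set_mset M"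
    using arg_cong[OF mset_w, of set_mset] by simp
  obtain p f where pf: "fpf_inv (length w) p" "f \<in> compat (length w) b p" "arc_word (length w) p f = w"
  proof (rule ex_compat_arc_word[of w b])
    show "sorted w" by (simp add: w_def)
    show "image_mset prod.swap (mset w) = mset w"
      by (simp add: mset_w multiset.map_comp o_def)
    show "(x, x) \<notin> set w" for x using lt by (auto simp: set_w)
    show "x < b" if "(x, y) \<in> set w" for x y using that lt by (fastforce simp: set_w)
  qed
  have "upper_arcs (2 * n) p f = filter_mset (\<lambda>(x, y). x < y) (mset w)"
    using pf len by (simp add: upper_arcs_def)
  also have "\<dots> = filter_mset (\<lambda>(x, y). x < y) M + filter_mset (\<lambda>(x, y). x < y) (image_mset prod.swap M)"
    by (simp add: mset_w)
  also have "filter_mset (\<lambda>(x, y). x < y) M = M"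
    using lt by (auto simp: filter_mset_eq_conv)
  also have "filter_mset (\<lambda>(x, y). x < y) (image_mset prod.swap M) = {#}"
    using lt by (subst filter_mset_image_mset) (auto dest: less_asym)
  finally show "M \<in> (\<lambda>(p, f). upper_arcs (2 * n) p f) ` (SIGMA p:{p. fpf_inv (2 * n) p}. compat (2 * n) b p)"
    using pf len by force
qed

section \<open>Double counting of compatible pairs\<close>

lemma finite_fpf_inv: "finite {p. fpf_inv m p}"
  by (rule finite_subset[OF _ finite_permutations[of "{1..m}"]]) (auto simp: fpf_inv_def)

lemma card_less_pairs: "card {(x, y). x < y \<and> y < b} = b choose 2" for b :: nat
proof (induction b)
  case (Suc b)
  have "{(x, y). x < y \<and> y < Suc b} = {(x, y). x < y \<and> y < b} \<union> (\<lambda>x. (x, b)) ` {..<b}"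
    by (auto simp: less_Suc_eq)
  moreover have "finite {(x, y). x < y \<and> y < b}"
    by (rule finite_subset[of _ "{..<b} \<times> {..<b}"]) auto
  ultimately have "card {(x, y). x < y \<and> y < Suc b} = (b choose 2) + card ((\<lambda>x. (x, b)) ` {..<b})"
    using Suc by (simp add: card_Un_disjoint disjoint_iff image_iff)
  also have "card ((\<lambda>x. (x, b)) ` {..<b}) = b" by (subst card_image) (auto simp: inj_on_def)
  finally show ?case by (simp add: numeral_2_eq_2)
qed simp

lemma des_le: "des m p \<le> m"
proof -
  have "des m p \<le> card {1..<m}" unfolding des_def by (rule card_mono) auto
  then show ?thesis by simp
qed

text \<open>Compatible pairs with values at most \<open>r\<close> are counted twice: grouped by the
  descent number of \<open>p\<close>, and through the bijection with multisets of \<open>n\<close>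
  of the \<open>Suc r choose 2\<close> pairs.\<close>

lemma sum_J_choose:
  "(\<Sum>d\<le>2 * n. J (2 * n) d * ((r + 2 * n - d) choose (2 * n))) = ((Suc r choose 2) + n - 1) choose n"
proof -
  let ?P = "{p. fpf_inv (2 * n) p}"
  have "(\<Sum>d\<le>2 * n. J (2 * n) d * ((r + 2 * n - d) choose (2 * n)))
      = (\<Sum>d\<le>2 * n. \<Sum>p | p \<in> ?P \<and> des (2 * n) p = d. (r + 2 * n - des (2 * n) p) choose (2 * n))"
    by (intro sum.cong) (auto simp: J_def)
  also have "\<dots> = (\<Sum>p\<in>?P. (r + 2 * n - des (2 * n) p) choose (2 * n))"
  proof (rule sum.group)
    show "des (2 * n) ` ?P \<subseteq> {..2 * n}" using des_le[of "2 * n"] by auto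
  qed (auto simp: finite_fpf_inv)
  also have "\<dots> = (\<Sum>p\<in>?P. card (compat (2 * n) (Suc r) p))"
  proof (intro sum.cong refl)
    fix p assume "p \<in> ?P"
    then have "compat (2 * n) (Suc r) p = marked_seqs (2 * n) (Suc r) {i \<in> {1..<2 * n}. p (Suc i) < p i}"
      by (intro compat_eq_marked_seqs) simp
    then show "(r + 2 * n - des (2 * n) p) choose (2 * n) = card (compat (2 * n) (Suc r) p)"
      unfolding des_def by (simp only: card_marked_seqs[OF Collect_restrict])
  qed
  also have "\<dots> = card (SIGMA p:?P. compat (2 * n) (Suc r) p)"
    by (rule card_SigmaI[symmetric]) (auto simp: finite_fpf_inv compat_eq_marked_seqs finite_marked_seqs)
  also have "\<dots> = card (multisets_of_size {(x, y). x < y \<and> y < Suc r} n)"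
    by (rule bij_betw_same_card[OF bij_betw_upper_arcs])
  also have "\<dots> = ((Suc r choose 2) + n - 1) choose n"
  proof (subst card_multisets_of_size)
    show "finite {(x, y). x < y \<and> y < Suc r}"
      by (rule finite_subset[of _ "{..<Suc r} \<times> {..<Suc r}"]) auto
  qed (simp only: card_less_pairs)
  finally show ?thesis .
qed

subsection \<open>The recurrence for the descent numbers\<close>

text \<open>Index shifts move the three-term operator from \<open>x\<close> to its adjoint on
  \<open>g\<close>. It serves both the recurrence for \<open>J\<close> and the one for
  \<open>gam\<close>.\<close>

lemma sum_three_term:
  fixes x g :: "nat \<Rightarrow> real"
  assumes "\<And>d. d > N \<Longrightarrow> x d = 0"
  shows "(\<Sum>k\<le>Suc (Suc N). (a k * x k + (if k = 0 then 0 else b k * x (k - 1))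
            + (if k < 2 then 0 else c k * x (k - 2))) * g k)
    = (\<Sum>d\<le>N. x d * (a d * g d + b (Suc d) * g (Suc d) + c (Suc (Suc d)) * g (Suc (Suc d))))"
proof -
  have "(\<Sum>k\<le>Suc (Suc N). a k * x k * g k) = (\<Sum>d\<le>N. x d * (a d * g d))"
    using assms by (simp add: mult_ac)
  moreover have "(\<Sum>k\<le>Suc (Suc N). (if k = 0 then 0 else b k * x (k - 1)) * g k)
      = (\<Sum>d\<le>N. x d * (b (Suc d) * g (Suc d)))"
    using assms by (subst sum.atMost_Suc_shift) (simp add: mult_ac)
  moreover have "(\<Sum>k\<le>Suc (Suc N). (if k < 2 then 0 else c k * x (k - 2)) * g k)
      = (\<Sum>d\<le>N. x d * (c (Suc (Suc d)) * g (Suc (Suc d))))"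
    by (subst sum.atMost_Suc_shift, subst sum.atMost_Suc_shift) (simp add: mult_ac)
  ultimately show ?thesis by (simp only: distrib_right distrib_left sum.distrib)
qed

lemma choose_Suc_real: "real (Suc k) * real (y choose Suc k) = (real y - real k) * real (y choose k)"
  using gbinomial_mult_1[of "real y" k] by (simp add: binomial_gbinomial algebra_simps)

lemma choose_weight_real: "(real y + 1 - real k) * real (Suc y choose k) = (real y + 1) * real (y choose k)"
proof (cases k)
  case (Suc l)
  have "real (Suc l) * real (Suc y choose Suc l) = (real y + 1) * real (y choose l)"
    using arg_cong[OF Suc_times_binomial_eq[of y l], of real] by (simp del: binomial_Suc_Suc add: algebra_simps)
  moreover have "real (Suc y choose Suc l) = real (y choose l) + real (y choose Suc l)" by simp
  ultimately show ?thesis unfolding Suc by (simp del: binomial_Suc_Suc add: algebra_simps)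
qed simp

text \<open>With \<open>N = 2n\<close>, the weight on the left is \<open>2 (n + 1)\<close> times the ratio of the values of \<open>sum_J_choose\<close> at \<open>n + 1\<close> and \<open>n\<close>.\<close>

lemma weighted_choose_expansion:
  fixes r N d :: nat
  assumes "d \<le> N"
  shows "(real r * (real r + 1) + real N) * real ((r + N - d) choose N)
    = (real d * (real d + 1) + N) * real ((r + (N + 2) - d) choose (N + 2))
    + 2 * (real d * (real N - real d) + 1) * real ((r + (N + 2) - Suc d) choose (N + 2))
    + ((real N - real d) * (real N - real d + 1) + N) * real ((r + (N + 2) - Suc (Suc d)) choose (N + 2))"
proof (cases "d \<le> r")
  case False
  with assms show ?thesis by (simp add: binomial_eq_0)
next
  case True
  define x where "x = r - d"
  have r: "r = x + d" using True by (simp add: x_def)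
  \<comment> \<open>The factor \<open>?P\<close> clears the denominators between lower index
    \<open>N + 2\<close> and \<open>N\<close>. All binomials become polynomial multiples of
    \<open>?u\<close>, and the claim reduces to the polynomial identity \<open>key\<close>.\<close>
  let ?P = "(real N + 1) * (real N + 2)"
  let ?u = "real ((x + N) choose N)"
  have two: "?P * real (y choose (N + 2)) = (real y - N) * (real y - N - 1) * real (y choose N)" for y
    using choose_Suc_real[of N y] choose_Suc_real[of "Suc N" y] by simp algebra
  have c0: "?P * real ((x + N) choose (N + 2)) = real x * (real x - 1) * ?u"
    using two[of "x + N"] by simp
  have w1: "(real x + 1) * real (Suc (x + N) choose N) = (real x + N + 1) * ?u"
    using choose_weight_real[of "x + N" N] by (simp add: algebra_simps)
  have w2: "(real x + 2) * real (Suc (Suc (x + N)) choose N) = (real x + N + 2) * real (Suc (x + N) choose N)"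
    using choose_weight_real[of "Suc (x + N)" N] by (simp add: algebra_simps)
  have c1: "?P * real (Suc (x + N) choose (N + 2)) = (real x + N + 1) * real x * ?u"
  proof -
    have "?P * real (Suc (x + N) choose (N + 2)) = real x * ((real x + 1) * real (Suc (x + N) choose N))"
      using two[of "Suc (x + N)"] by (simp del: binomial_Suc_Suc add: algebra_simps)
    then show ?thesis unfolding w1 by simp
  qed
  have c2: "?P * real (Suc (Suc (x + N)) choose (N + 2)) = (real x + N + 2) * (real x + N + 1) * ?u"
  proof -
    have "?P * real (Suc (Suc (x + N)) choose (N + 2)) = (real x + 2) * (real x + 1) * real (Suc (Suc (x + N)) choose N)"
      using two[of "Suc (Suc (x + N))"] by (simp del: binomial_Suc_Suc add: algebra_simps)
    then show ?thesis using w1 w2 by algebra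
  qed
  have idx: "r + N - d = x + N" "r + (N + 2) - d = Suc (Suc (x + N))"
      "r + (N + 2) - Suc d = Suc (x + N)" "r + (N + 2) - Suc (Suc d) = x + N"
    using assms by (auto simp: r)
  have key: "?P * (real r * (real r + 1) + real N) =
     (real d * (real d + 1) + N) * ((real x + N + 2) * (real x + N + 1))
    + 2 * (real d * (real N - real d) + 1) * ((real x + N + 1) * real x)
    + ((real N - real d) * (real N - real d + 1) + N) * (real x * (real x - 1))"
    unfolding r of_nat_add by algebra
  have "?P * ((real r * (real r + 1) + real N) * ?u) =
     (real d * (real d + 1) + N) * ((real x + N + 2) * (real x + N + 1) * ?u)
    + 2 * (real d * (real N - real d) + 1) * ((real x + N + 1) * real x * ?u)
    + ((real N - real d) * (real N - real d + 1) + N) * (real x * (real x - 1) * ?u)"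
  proof -
    \<comment> \<open>With the coefficients abstracted to variables, this only multiplies
      \<open>key\<close> through by \<open>?u\<close>.\<close>
    have "p * (w * u) = a * (x * u) + b * (y * u) + c * (z * u)"
      if "p * w = a * x + b * y + c * z" for p w u a x b y c z :: real
      using that by algebra
    from this[OF key] show ?thesis .
  qed
  also have "\<dots> = ?P * ((real d * (real d + 1) + N) * real (Suc (Suc (x + N)) choose (N + 2))
    + 2 * (real d * (real N - real d) + 1) * real (Suc (x + N) choose (N + 2))
    + ((real N - real d) * (real N - real d + 1) + N) * real ((x + N) choose (N + 2)))"
    unfolding c0[symmetric] c1[symmetric] c2[symmetric] distrib_left[of ?P] by (simp only: mult.left_commute)
  finally show ?thesis unfolding idx by simp
qed

text \<open>Triangularity: at \<open>r = k\<close> the terms with \<open>d > k\<close> vanish and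
  the binomial at \<open>d = k\<close> is 1, so the coefficients vanish one after another.\<close>

lemma choose_family_independent:
  fixes e :: "nat \<Rightarrow> real"
  assumes "\<And>r. (\<Sum>d\<le>N. e d * real ((r + N - d) choose N)) = 0" and "k \<le> N"
  shows "e k = 0"
  using assms(2)
proof (induction k rule: less_induct)
  case (less k)
  have "(\<Sum>d\<le>N. e d * real ((k + N - d) choose N)) = (\<Sum>d\<in>{k}. e d * real ((k + N - d) choose N))"
  proof (rule sum.mono_neutral_right)
    show "\<forall>d\<in>{..N} - {k}. e d * real ((k + N - d) choose N) = 0"
    proof
      fix d assume d: "d \<in> {..N} - {k}"
      show "e d * real ((k + N - d) choose N) = 0"
        using d less by (cases "d < k") (auto simp: binomial_eq_0)
    qed
  qed (use less in auto)
  with assms(1)[of k] show ?case by simp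
qed

lemma J_eq_0: "m < j \<Longrightarrow> J m j = 0"
proof -
  assume "m < j"
  then have "{p. fpf_inv m p \<and> des m p = j} = {}" using des_le[of m] by (auto simp: not_le[symmetric])
  then show ?thesis by (simp only: J_def card.empty)
qed

text \<open>With \<open>s = Suc r choose 2\<close>, absorption gives the ratio
  \<open>(s + n) / (n + 1)\<close> of consecutive values of \<open>sum_J_choose\<close>, and
  \<open>2 * s = r * (r + 1)\<close>.\<close>

lemma sum_J_choose_Suc:
  "2 * (real n + 1) * (\<Sum>d\<le>2 * n + 2. real (J (2 * n + 2) d) * real ((r + (2 * n + 2) - d) choose (2 * n + 2)))
   = (real r * (real r + 1) + 2 * real n) * (\<Sum>d\<le>2 * n. real (J (2 * n) d) * real ((r + 2 * n - d) choose (2 * n)))"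
proof -
  let ?s = "Suc r choose 2"
  have s: "2 * real ?s = real r * (real r + 1)"
    using choose_Suc_real[of 1 "Suc r"] by (simp del: binomial_Suc_Suc add: numeral_2_eq_2 algebra_simps)
  have "(real n + 1) * real ((?s + n) choose Suc n) = (real ?s + n) * real ((?s + n - 1) choose n)"
  proof (cases "?s + n")
    case (Suc y)
    have "real (Suc y) = real ?s + n" by (simp only: Suc[symmetric] of_nat_add)
    moreover have "real (Suc y) * real (y choose n) = real (Suc y choose Suc n) * (real n + 1)"
      using arg_cong[OF Suc_times_binomial_eq[of y n], of real] by (simp del: binomial_Suc_Suc add: algebra_simps)
    ultimately show ?thesis unfolding Suc by (simp del: binomial_Suc_Suc add: mult.commute)
  qed (simp flip: of_nat_add)
  moreover have "(\<Sum>d\<le>2 * n + 2. real (J (2 * n + 2) d) * real ((r + (2 * n + 2) - d) choose (2 * n + 2)))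
      = real ((?s + n) choose Suc n)"
    using arg_cong[OF sum_J_choose[of "Suc n" r], of real] by (simp del: binomial_Suc_Suc)
  moreover have "(\<Sum>d\<le>2 * n. real (J (2 * n) d) * real ((r + 2 * n - d) choose (2 * n)))
      = real ((?s + n - 1) choose n)"
    using arg_cong[OF sum_J_choose[of n r], of real] by simp
  ultimately show ?thesis using s by algebra
qed

text \<open>\<open>weighted_choose_expansion\<close> rewrites the weighted sum of
  \<open>sum_J_choose_Suc\<close> in the basis for \<open>2 * n + 2\<close>;
  \<open>sum_three_term\<close> collects it by basis element, and independence compares
  coefficients.\<close>

lemma J_recurrence:
  fixes n k :: nat
  defines "N \<equiv> 2 * real n"
  shows "2 * (real n + 1) * real (J (2 * n + 2) k)
    = (real k * (real k + 1) + N) * real (J (2 * n) k)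
    + (if k = 0 then 0 else 2 * ((real k - 1) * (N + 1 - real k) + 1) * real (J (2 * n) (k - 1)))
    + (if k < 2 then 0 else ((N + 2 - real k) * (N + 3 - real k) + N) * real (J (2 * n) (k - 2)))"
    (is "_ = ?rhs k")
proof (cases "k \<le> 2 * n + 2")
  case False
  then show ?thesis by (simp add: J_eq_0)
next
  case True
  let ?g = "\<lambda>r d. real ((r + (2 * n + 2) - d) choose (2 * n + 2))"
  have "(\<Sum>k\<le>2 * n + 2. ?rhs k * ?g r k)
     = 2 * (real n + 1) * (\<Sum>d\<le>2 * n + 2. real (J (2 * n + 2) d) * ?g r d)" for r
  proof -
    have "(\<Sum>k\<le>2 * n + 2. ?rhs k * ?g r k) = (\<Sum>d\<le>2 * n. real (J (2 * n) d) *
        ((real d * (real d + 1) + N) * ?g r d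
       + 2 * ((real (Suc d) - 1) * (N + 1 - real (Suc d)) + 1) * ?g r (Suc d)
       + ((N + 2 - real (Suc (Suc d))) * (N + 3 - real (Suc (Suc d))) + N) * ?g r (Suc (Suc d))))"
      unfolding add_2_eq_Suc' by (rule sum_three_term) (simp add: J_eq_0)
    also have "\<dots> = (\<Sum>d\<le>2 * n. real (J (2 * n) d) *
        ((real r * (real r + 1) + 2 * real n) * real ((r + 2 * n - d) choose (2 * n))))"
    proof (intro sum.cong refl arg_cong2[of _ _ _ _ "(*)"])
      fix d assume "d \<in> {..2 * n}"
      then show "(real d * (real d + 1) + N) * ?g r d
       + 2 * ((real (Suc d) - 1) * (N + 1 - real (Suc d)) + 1) * ?g r (Suc d)
       + ((N + 2 - real (Suc (Suc d))) * (N + 3 - real (Suc (Suc d))) + N) * ?g r (Suc (Suc d))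
       = (real r * (real r + 1) + 2 * real n) * real ((r + 2 * n - d) choose (2 * n))"
        using weighted_choose_expansion[of d "2 * n" r]
        by (simp del: binomial_Suc_Suc add: N_def add_diff_eq)
    qed
    also have "\<dots> = 2 * (real n + 1) * (\<Sum>d\<le>2 * n + 2. real (J (2 * n + 2) d) * ?g r d)"
      unfolding sum_J_choose_Suc by (simp add: sum_distrib_left mult_ac)
    finally show ?thesis .
  qed
  then have "(\<Sum>k\<le>2 * n + 2. (2 * (real n + 1) * real (J (2 * n + 2) k) - ?rhs k) * ?g r k) = 0" for r
    by (simp only: left_diff_distrib sum_subtractf) (simp only: sum_distrib_left mult.assoc diff_self)
  from choose_family_independent[OF this True] show ?thesis by simp
qed

subsection \<open>The gamma expansion and its inversion\<close>

text \<open>The coefficient of \<open>t^i\<close> in \<open>(1 + t)^M\<close> for every integer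
  \<open>i\<close>; zero at negative indices lets Pascal's rule and the ratio identity hold without
  boundary cases.\<close>

definition ichoose :: "nat \<Rightarrow> int \<Rightarrow> real" where
  "ichoose M i = (if i < 0 then 0 else real (M choose nat i))"

lemma ichoose_neg [simp]: "i < 0 \<Longrightarrow> ichoose M i = 0"
  by (simp add: ichoose_def)

lemma ichoose_of_nat: "ichoose M (int k) = real (M choose k)"
  by (simp add: ichoose_def)

lemma ichoose_Suc: "ichoose (Suc M) i = ichoose M i + ichoose M (i - 1)"
proof (cases "i \<le> 0")
  case False
  then obtain k where "i = int (Suc k)" by (metis not_le zero_less_imp_eq_int gr0_conv_Suc)
  then show ?thesis by (simp add: ichoose_def nat_diff_distrib Suc_nat_eq_nat_zadd1[symmetric])
qed (auto simp: ichoose_def)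

lemma ichoose_ratio: "of_int i * ichoose M i = (real M - of_int i + 1) * ichoose M (i - 1)"
proof (cases "i \<le> 0")
  case False
  then obtain k where i: "i = int (Suc k)" by (metis not_le zero_less_imp_eq_int gr0_conv_Suc)
  have "ichoose M i = real (M choose Suc k)" "ichoose M (i - 1) = real (M choose k)"
    unfolding i using ichoose_of_nat[of M "Suc k"] ichoose_of_nat[of M k] by simp_all
  then show ?thesis using choose_Suc_real[of k M] by (simp add: i algebra_simps)
qed (auto simp: ichoose_def)

lemma ichoose_absorb: "of_int i * ichoose M i = real M * ichoose (M - 1) (i - 1)"
proof (cases "i \<le> 0")
  case False
  then obtain k where i: "i = int (Suc k)" by (metis not_le zero_less_imp_eq_int gr0_conv_Suc)
  have "ichoose M i = real (M choose Suc k)" "ichoose (M - 1) (i - 1) = real ((M - 1) choose k)"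
    unfolding i using ichoose_of_nat[of M "Suc k"] ichoose_of_nat[of "M - 1" k] by simp_all
  then show ?thesis using arg_cong[OF binomial_absorption[of k M], of real]
    by (simp add: i algebra_simps)
qed (auto simp: ichoose_def)

lemma ichoose_absorb2:
  "of_int i * (of_int i - 1) * ichoose M i = real M * (real M - 1) * ichoose (M - 2) (i - 2)"
proof (cases "M = 0")
  case True
  then show ?thesis using ichoose_absorb[of i M] by auto
next
  case False
  have "of_int (i - 1) * ichoose (M - 1) (i - 1) = real (M - 1) * ichoose (M - 1 - 1) (i - 1 - 1)"
    by (rule ichoose_absorb)
  moreover have "M - 1 - 1 = M - 2" "i - 1 - 1 = i - 2" "real (M - 1) = real M - 1"
    using False by auto
  ultimately have "of_int (i - 1) * ichoose (M - 1) (i - 1) = (real M - 1) * ichoose (M - 2) (i - 2)"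
    by simp
  then show ?thesis using ichoose_absorb[of i M] by (simp add: algebra_simps) algebra
qed

text \<open>The coefficient form of how the recurrence operator of \<open>J_recurrence\<close> acts on \<open>t\<^sup>j (1 + t)\<^sup>M\<close>.\<close>

lemma gamma_basis_step:
  fixes i :: int and j M :: nat
  defines "K \<equiv> of_int i + real j" and "N \<equiv> real M + 2 * real j"
  shows "(K * (K + 1) + N) * ichoose M i + 2 * ((K - 1) * (N + 1 - K) + 1) * ichoose M (i - 1)
      + ((N + 2 - K) * (N + 3 - K) + N) * ichoose M (i - 2)
    = (real j * (real j + 1) + N) * ichoose (M + 2) i
      + (2 + 2 * real j * (2 * real M - 3)) * ichoose M (i - 1)
      + 4 * real M * (real M - 1) * ichoose (M - 2) (i - 2)"
proof -
  define x where "x = (of_int i :: real)"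
  define u0 u1 u2 where "u0 = ichoose M i" and "u1 = ichoose M (i - 1)" and "u2 = ichoose M (i - 2)"
  have s: "ichoose (M + 2) i = u0 + 2 * u1 + u2"
    by (simp add: ichoose_Suc u0_def u1_def u2_def)
  have e1: "x * u0 = (M - x + 1) * u1" using ichoose_ratio[of i M] by (simp add: x_def u0_def u1_def)
  have e2: "(x - 1) * u1 = (M - x + 2) * u2"
    using ichoose_ratio[of "i - 1" M] by (simp add: x_def u2_def u1_def)
  have e3: "4 * real M * (real M - 1) * ichoose (M - 2) (i - 2) = 4 * x * (x - 1) * u0"
    using ichoose_absorb2[of i M] by (simp add: x_def u0_def)
  \<comment> \<open>In the difference of the two sides, \<open>u0\<close> has coefficient
    \<open>x * (2 * j + 5 - 3 * x)\<close> and \<open>u2\<close> has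
    \<open>(M - x + 2) * (M - x + 2 * j + 3)\<close>. These multiples of \<open>e1\<close> and
    \<open>e2\<close> move both terms onto \<open>u1\<close>, where everything cancels.\<close>
  have f1: "(2 * real j + 5 - 3 * x) * (x * u0) = (2 * real j + 5 - 3 * x) * ((M - x + 1) * u1)"
    by (simp only: e1)
  have f2: "(M - x + 2 * real j + 3) * ((x - 1) * u1) = (M - x + 2 * real j + 3) * ((M - x + 2) * u2)"
    by (simp only: e2)
  show ?thesis
    unfolding s e3 K_def N_def u0_def[symmetric] u1_def[symmetric] u2_def[symmetric] x_def[symmetric]
    using f1 f2 by (simp add: algebra_simps)
qed

text \<open>The recurrence of the theorem with \<open>n\<close> replaced by \<open>n + 1\<close>,
  taken as a definition and started at the empty involution; \<open>bcoef_eq_gam\<close> later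
  identifies its solution with \<open>bcoef\<close>.\<close>

primrec gam :: "nat \<Rightarrow> nat \<Rightarrow> real" where
  "gam 0 = (\<lambda>k. if k = 0 then 1 else 0)"
| "gam (Suc n) = (\<lambda>k. ((real k * (real k + 1) + 2 * real n) * gam n k
      + (if k = 0 then 0 else (2 + 2 * (real k - 1) * (4 * real n - 4 * real k + 1)) * gam n (k - 1))
      + (if k < 2 then 0 else 8 * (real n - real k + 2) * (2 * real n - 2 * real k + 3) * gam n (k - 2)))
     / (2 * (real n + 1)))"

lemma gam_Suc:
  "2 * (real n + 1) * gam (Suc n) k = (real k * (real k + 1) + 2 * real n) * gam n k
      + (if k = 0 then 0 else (2 + 2 * (real k - 1) * (4 * real n - 4 * real k + 1)) * gam n (k - 1))
      + (if k < 2 then 0 else 8 * (real n - real k + 2) * (2 * real n - 2 * real k + 3) * gam n (k - 2))"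
  by (simp add: add_nonneg_eq_0_iff)

text \<open>Beyond index \<open>n + 1\<close>, the only contribution from the support is that of
  \<open>gam n n\<close> at \<open>k = n + 2\<close>, where the factor \<open>n - k + 2\<close> is
  zero.\<close>

lemma gam_eq_0: "n < k \<Longrightarrow> gam n k = 0"
proof (induction n arbitrary: k)
  case (Suc n)
  have "8 * (real n - real k + 2) * (2 * real n - 2 * real k + 3) * gam n (k - 2) = 0"
    using Suc by (cases "k = n + 2") auto
  with Suc show ?case by (simp add: not_less)
qed simp

lemma gam_0: "n > 0 \<Longrightarrow> gam n 0 = 0"
proof (induction n)
  case (Suc n)
  then show ?case by (cases n) auto
qed simp

text \<open>Induction on \<open>n\<close>: \<open>J_recurrence\<close> acts on each basis polynomial
  \<open>t^j * (1 + t)^(2n - 2j)\<close> by \<open>gamma_basis_step\<close>, and collecting by basis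
  polynomial with \<open>sum_three_term\<close> reproduces the recurrence of
  \<open>gam\<close>.\<close>

lemma J_gamma_expansion:
  "real (J (2 * n) k) = (\<Sum>j\<le>n. gam n j * ichoose (2 * n - 2 * j) (int k - int j))"
proof (induction n arbitrary: k)
  case 0
  have "{p. fpf_inv 0 p \<and> des 0 p = 0} = {id}" by (auto simp: fpf_inv_def des_def)
  then have "J 0 0 = 1" by (simp add: J_def)
  then show ?case by (cases k) (simp_all add: J_eq_0 ichoose_def)
next
  case (Suc n)
  let ?u = "\<lambda>j i. ichoose (2 * n - 2 * j) (int k - int j - i)"
  let ?N = "2 * real n"
  \<comment> \<open>The basis for \<open>n + 1\<close>: at \<open>j\<close>, \<open>j + 1\<close>,
    \<open>j + 2\<close> its exponents are \<open>M + 2\<close>, \<open>M\<close>,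
    \<open>M - 2\<close> with \<open>M = 2 * n - 2 * j\<close>. At \<open>j = n\<close> the last one
    is truncated, but its coefficient is then zero.\<close>
  let ?g = "\<lambda>j. ichoose (2 * n + 2 - 2 * j) (int k - int j)"
  let ?a = "real k * (real k + 1) + ?N"
  let ?b = "2 * ((real k - 1) * (?N + 1 - real k) + 1)"
  let ?c = "(?N + 2 - real k) * (?N + 3 - real k) + ?N"
  have k0: "real (J (2 * n) k) = (\<Sum>j\<le>n. gam n j * ?u j 0)" using Suc by simp
  have k1: "(if k = 0 then 0 else ?b * real (J (2 * n) (k - 1))) = ?b * (\<Sum>j\<le>n. gam n j * ?u j 1)"
    using Suc[of "k - 1"] by (auto simp: of_nat_diff algebra_simps intro!: sum.cong)
  have k2: "(if k < 2 then 0 else ?c * real (J (2 * n) (k - 2))) = ?c * (\<Sum>j\<le>n. gam n j * ?u j 2)"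
    using Suc[of "k - 2"] by (auto simp: of_nat_diff algebra_simps intro!: sum.cong)
  have "2 * (real n + 1) * real (J (2 * n + 2) k)
      = (\<Sum>j\<le>n. gam n j * (?a * ?u j 0 + ?b * ?u j 1 + ?c * ?u j 2))"
    unfolding J_recurrence k0 k1 k2 sum_distrib_left sum.distrib[symmetric]
    by (intro sum.cong refl) (simp only: distrib_left mult.left_commute)
  also have "\<dots> = (\<Sum>j\<le>n. gam n j * ((real j * (real j + 1) + ?N) * ?g j
        + (2 + 2 * (real (Suc j) - 1) * (4 * real n - 4 * real (Suc j) + 1)) * ?g (Suc j)
        + (8 * (real n - real (Suc (Suc j)) + 2) * (2 * real n - 2 * real (Suc (Suc j)) + 3)) * ?g (Suc (Suc j))))"
  proof (intro sum.cong refl arg_cong2[of _ _ _ _ "(*)"])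
    fix j assume "j \<in> {..n}"
    then have M: "real (2 * n - 2 * j) = ?N - 2 * real j" "2 * n - 2 * j + 2 = 2 * n + 2 - 2 * j"
      by (auto simp: of_nat_diff)
    have g: "?g (Suc j) = ?u j 1" "?g (Suc (Suc j)) = ichoose (2 * n - 2 * j - 2) (int k - int j - 2)"
      by (simp_all add: algebra_simps)
    have coeffs: "2 + 2 * (real (Suc j) - 1) * (4 * real n - 4 * real (Suc j) + 1)
          = 2 + 2 * real j * (2 * (?N - 2 * real j) - 3)"
        "8 * (real n - real (Suc (Suc j)) + 2) * (2 * real n - 2 * real (Suc (Suc j)) + 3)
          = 4 * (?N - 2 * real j) * (?N - 2 * real j - 1)"
      by (simp_all add: algebra_simps)
    show "?a * ?u j 0 + ?b * ?u j 1 + ?c * ?u j 2 = (real j * (real j + 1) + ?N) * ?g j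
        + (2 + 2 * (real (Suc j) - 1) * (4 * real n - 4 * real (Suc j) + 1)) * ?g (Suc j)
        + (8 * (real n - real (Suc (Suc j)) + 2) * (2 * real n - 2 * real (Suc (Suc j)) + 3)) * ?g (Suc (Suc j))"
      using gamma_basis_step[of "int k - int j" j "2 * n - 2 * j"]
      unfolding M g coeffs by simp
  qed
  also have "\<dots> = (\<Sum>j\<le>Suc (Suc n). 2 * (real n + 1) * gam (Suc n) j * ?g j)"
    unfolding gam_Suc by (rule sum_three_term[symmetric]) (rule gam_eq_0)
  also have "\<dots> = 2 * (real n + 1) * (\<Sum>j\<le>Suc n. gam (Suc n) j * ?g j)"
    by (simp del: gam.simps add: gam_eq_0 sum_distrib_left distrib_left mult.assoc)
  finally show ?case by (simp del: gam.simps sum.atMost_Suc add: add_nonneg_eq_0_iff)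
qed

text \<open>Rewriting the weight with upper negation makes the inversion of \<open>J_gamma_expansion\<close> a Vandermonde convolution.\<close>

definition inv_weight :: "nat \<Rightarrow> nat \<Rightarrow> nat \<Rightarrow> real" where
  "inv_weight m j i = ((2 * real j - 2 * real m - 1) gchoose (j - i))
     - (if i < j then (2 * real j - 2 * real m - 1) gchoose (j - 1 - i) else 0)"

text \<open>Upper negation produces the sign and two ordinary binomials, which absorption merges
  into one with the fraction in front. The hypothesis \<open>i < m\<close> excludes
  \<open>i = j = m\<close>, where that fraction is 0 / 0.\<close>

lemma inv_weight_eq:
  assumes "i \<le> j" "j \<le> m" "i < m"
  shows "(-1) ^ (j - i) * (real (2*m - 2*i) / real (2*m - j - i)) * real ((2*m - j - i) choose (j - i))
    = inv_weight m j i"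
proof (cases "i = j")
  case True
  with assms show ?thesis by (simp add: inv_weight_def)
next
  case False
  define k where "k = j - i - 1"
  define n where "n = 2 * m - j - i - 1"
  have ji: "j - i = Suc k" "j - 1 - i = k" and n: "2 * m - j - i = Suc n" "2 * m - 2 * i = Suc n + Suc k"
    using assms False by (auto simp: k_def n_def)
  have "real j - real i = real k + 1" using ji(1) assms by linarith
  moreover have "2 * real m - real j - real i = real n + 1" using n(1) by linarith
  ultimately have r: "2 * real j - 2 * real m - 1 = real k - real n - 1" by linarith
  have "(2 * real j - 2 * real m - 1) gchoose Suc k = (-1) ^ Suc k * real (Suc n choose Suc k)"
    unfolding r by (subst gbinomial_negated_upper) (simp add: binomial_gbinomial del: binomial_Suc_Suc)
  moreover have "(2 * real j - 2 * real m - 1) gchoose k = (-1) ^ k * real (n choose k)"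
    unfolding r by (subst gbinomial_negated_upper) (simp add: binomial_gbinomial)
  ultimately have "inv_weight m j i = (-1) ^ Suc k * (real (Suc n choose Suc k) + real (n choose k))"
    using assms False unfolding inv_weight_def ji by (simp add: algebra_simps del: binomial_Suc_Suc)
  moreover have "real (n choose k) = real (Suc k) * real (Suc n choose Suc k) / real (Suc n)"
    using arg_cong[OF Suc_times_binomial_eq[of n k], of real]
    by (simp del: binomial_Suc_Suc add: field_simps)
  ultimately show ?thesis unfolding ji n
    by (simp del: binomial_Suc_Suc add: field_simps)
qed

text \<open>With \<open>s = j - l\<close>, Vandermonde turns the two parts of the weight into
  \<open>2 * s - 1\<close> over \<open>s\<close> and over \<open>s - 1\<close>, which cancel by
  symmetry of binomials. For \<open>s = 0\<close> only the first part remains, with value 1.\<close>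

lemma inv_weight_orthogonal:
  assumes "j \<le> m"
  shows "(\<Sum>i\<le>j. inv_weight m j i * ichoose (2 * m - 2 * l) (int i - int l)) = (if l = j then 1 else 0)"
proof (cases "l \<le> j")
  case False
  then show ?thesis by (auto intro!: sum.neutral)
next
  case True
  define s where "s = j - l"
  have j: "j = l + s" using True by (simp add: s_def)
  let ?a = "2 * real j - 2 * real m - 1" and ?M = "2 * m - 2 * l"
  have top: "real ?M + ?a = 2 * real s - 1" using assms by (simp add: j of_nat_diff)
  have V: "(\<Sum>i\<le>t. (?a gchoose (t - i)) * real (?M choose i)) = (2 * real s - 1) gchoose t" for t
    using gbinomial_Vandermonde[of "real ?M" ?a t] unfolding top
    by (simp add: atMost_atLeast0 binomial_gbinomial mult.commute)
  have "(\<Sum>i\<le>j. inv_weight m j i * ichoose ?M (int i - int l))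
      = (\<Sum>i\<in>{l..j}. inv_weight m j i * ichoose ?M (int i - int l))"
    by (rule sum.mono_neutral_right) auto
  also have "\<dots> = (\<Sum>i\<le>s. inv_weight m j (i + l) * real (?M choose i))"
    unfolding j by (rule sum.reindex_bij_witness[of _ "\<lambda>i. i + l" "\<lambda>i. i - l"])
      (auto simp: ichoose_def nat_diff_distrib)
  also have "\<dots> = (\<Sum>i\<le>s. (?a gchoose (s - i)) * real (?M choose i))
      - (\<Sum>i\<le>s. (if i < s then ?a gchoose (s - 1 - i) else 0) * real (?M choose i))"
    unfolding sum_subtractf[symmetric] left_diff_distrib[symmetric]
    by (intro sum.cong) (auto simp: inv_weight_def j)
  also have "\<dots> = (if l = j then 1 else 0)"
  proof (cases s)
    case 0
    then show ?thesis by (simp add: j)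
  next
    case (Suc t)
    have "(\<Sum>i\<le>s. (if i < s then ?a gchoose (s - 1 - i) else 0) * real (?M choose i))
        = (\<Sum>i\<le>t. (?a gchoose (t - i)) * real (?M choose i))"
      unfolding Suc by (simp cong: sum.cong_simp)
    moreover have "(2 * real s - 1) gchoose s = (2 * real s - 1) gchoose t"
    proof -
      have "2 * real s - 1 = real (2 * t + 1)" by (simp add: Suc)
      moreover have "(2 * t + 1) choose s = (2 * t + 1) choose t"
        using binomial_symmetric[of s "2 * t + 1"] by (simp add: Suc)
      ultimately show ?thesis by (simp only: binomial_gbinomial[symmetric])
    qed
    ultimately show ?thesis unfolding V by (simp add: j Suc)
  qed
  finally show ?thesis .
qed

text \<open>For \<open>1 \<le> j \<le> m\<close>, inserting \<open>J_gamma_expansion\<close> into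
  the defining sum and exchanging the sums lets orthogonality select \<open>gam m j\<close>. At
  \<open>m = 0\<close> the two differ, since \<open>gam 0 0 = 1\<close>.\<close>

lemma bcoef_eq_gam:
  assumes "m > 0"
  shows "bcoef m (int j) = gam m j"
proof -
  consider "j = 0" | "j > m" | "1 \<le> j" "j \<le> m" by linarith
  then show ?thesis
  proof cases
    case 1
    then show ?thesis using assms by (simp add: bcoef_def gam_0)
  next
    case 2
    then show ?thesis by (simp add: bcoef_def gam_eq_0)
  next
    case 3
    \<comment> \<open>This allows the defining sum to be extended to \<open>i = 0\<close>, as in
      \<open>inv_weight_orthogonal\<close>.\<close>
    have J0: "real (J (2 * m) 0) = 0"
    proof -
      have "gam m l * ichoose (2 * m - 2 * l) (int 0 - int l) = 0" for l
        using assms by (cases l) (auto simp: gam_0)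
      then show ?thesis unfolding J_gamma_expansion by (simp only: sum.neutral_const)
    qed
    have "bcoef m (int j) = (\<Sum>i = 1..j. inv_weight m j i * real (J (2 * m) i))"
    proof (cases "j = m")
      case False
      then have "bcoef m (int j) = (\<Sum>i = 1..j. (-1) ^ (j - i) * (real (2*m - 2*i) / real (2*m - j - i))
              * real ((2*m - j - i) choose (j - i)) * real (J (2*m) i))"
        using 3 by (simp add: bcoef_def)
      also have "\<dots> = (\<Sum>i = 1..j. inv_weight m j i * real (J (2 * m) i))"
        using 3 False by (intro sum.cong refl arg_cong2[of _ _ _ _ "(*)"] inv_weight_eq) auto
      finally show ?thesis .
    next
      case True
      then have "bcoef m (int j) = (\<Sum>i = 1..j - 1. (-1) ^ (j - i) * (real (2*m - 2*i) / real (2*m - j - i))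
              * real ((2*m - j - i) choose (j - i)) * real (J (2*m) i)) + real (J (2 * m) j)"
        using 3 by (simp add: bcoef_def)
      also have "(\<Sum>i = 1..j - 1. (-1) ^ (j - i) * (real (2*m - 2*i) / real (2*m - j - i))
              * real ((2*m - j - i) choose (j - i)) * real (J (2*m) i))
          = (\<Sum>i = 1..j - 1. inv_weight m j i * real (J (2 * m) i))"
        using 3 True by (intro sum.cong refl arg_cong2[of _ _ _ _ "(*)"] inv_weight_eq) auto
      \<comment> \<open>The separate summand of the case \<open>j = m\<close> is the diagonal term,
        because \<open>inv_weight m j j = 1\<close>.\<close>
      also have "\<dots> + real (J (2 * m) j) = (\<Sum>i = 1..j. inv_weight m j i * real (J (2 * m) i))"
        using 3 by (cases j) (auto simp: inv_weight_def)
      finally show ?thesis .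
    qed
    also have "\<dots> = (\<Sum>i\<le>j. inv_weight m j i * real (J (2 * m) i))"
      by (rule sum.mono_neutral_left) (use J0 in \<open>auto simp: not_le less_Suc_eq_0_disj Suc_le_eq\<close>)
    also have "\<dots> = (\<Sum>l\<le>m. gam m l * (\<Sum>i\<le>j. inv_weight m j i * ichoose (2 * m - 2 * l) (int i - int l)))"
      unfolding J_gamma_expansion sum_distrib_left by (subst sum.swap) (simp only: mult.left_commute)
    also have "\<dots> = (\<Sum>l\<le>m. gam m l * (if l = j then 1 else 0))"
      using 3 by (simp only: inv_weight_orthogonal)
    also have "\<dots> = gam m j" using 3 by (simp add: if_distrib[of "(*) _"] cong: if_cong)
    finally show ?thesis .
  qed
qed

theorem theorem4p4:
  fixes n :: nat and k :: int
  assumes "n \<ge> 2" and "k \<ge> 1"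
  shows "2 * real n * bcoef n k =
           real_of_int (k * (k + 1) + 2 * int n - 2) * bcoef (n - 1) k
         + real_of_int (2 + 2 * (k - 1) * (4 * int n - 4 * k - 3)) * bcoef (n - 1) (k - 1)
         + real_of_int (8 * (int n - k + 1) * (2 * int n - 2 * k + 1)) * bcoef (n - 1) (k - 2)"
proof -
  \<comment> \<open>From \<open>n \<ge> 2\<close> comes \<open>m > 0\<close>, so
    \<open>bcoef_eq_gam\<close> applies at both levels \<open>n\<close> and
    \<open>n - 1\<close>.\<close>
  obtain m where n: "n = Suc m" and m: "m > 0" using assms(1) by (cases n) auto
  obtain j where k: "k = int j" and j: "j \<ge> 1" using assms(2) by (cases k) auto
  have b: "bcoef n k = gam (Suc m) j" "bcoef (n - 1) k = gam m j"
    "bcoef (n - 1) (k - 1) = gam m (j - 1)"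
    using m j bcoef_eq_gam[of "Suc m" j] bcoef_eq_gam[of m j] bcoef_eq_gam[of m "j - 1"]
    by (simp_all add: n k del: gam.simps)
  \<comment> \<open>For \<open>j = 1\<close> the integer index \<open>k - 2\<close> is negative and
    \<open>bcoef\<close> is 0; the guard matches the one in \<open>gam_Suc\<close>.\<close>
  have b2: "bcoef (n - 1) (k - 2) = (if j < 2 then 0 else gam m (j - 2))"
  proof (cases "j < 2")
    case True
    then show ?thesis by (simp add: k bcoef_def)
  next
    case False
    then show ?thesis using bcoef_eq_gam[OF m, of "j - 2"] by (simp add: n k of_nat_diff)
  qed
  show ?thesis
    using gam_Suc[of m j] j unfolding b b2 unfolding n k
    by (cases "j < 2") (simp_all del: gam.simps add: algebra_simps)
qed

end
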